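(* Let $S=\langle a_1,\ldots,a_n\rangle\subset\mathbb{Z}^{d}$ be a pointed affine semigroup. Let $w=(w_1,\ldots,w_n)\in\mathbb{N}^n$. Assume that $\operatorname{Betti}(S)=\{b\}$ and $\operatorname{Betti}(S_w)=\{(b,d_w)\}$. Then the Möbius function of $S_w$ can be computed in terms of data of $S$. More precisely, let $(z,\lambda)\in S_w$ (with $z\in S$), let $$\mathfrak{a}_z:=\Big\{A\subset\{1,\ldots,n\}\ \Big|\ \exists\,k_A\in\mathbb{N}\text{ such that }z=\sum_{i\in A}a_i+k_Ab\Big\},$$ write $\mathfrak{a}_z=\{A_1,\ldots,A_r\}$, and for each $j\in\{1,\ldots,r\}$ let $l_j=\sum_{i\in A_j}w_i+k_{A_j}d_w$. Then $\mu_{S_w}(z,\lambda)=0$ whenever $\mathfrak{a}_z=\emptyset$ or $\lambda\notin\{l_j,l_j+1\}_{j=1}^r$. If $\mathfrak{a}_z=\{A_1,\ldots,A_r\}$ (with $r\geq1$) and $\lambda\in\{l_j,l_j+1\}_{j=1}^r$, then $$\mu_{S_w}(z,\lambda)=\sum_{j:\,\lambda=l_j}(-1)^{|A_j|}\binom{k_{A_j}+n-d-1}{k_{A_j}}-\sum_{j:\,\lambda=l_j+1}(-1)^{|A_j|}\binom{k_{A_j}+n-d-1}{k_{A_j}}.$$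
   Context: $\mathbb{N}$ contains $0$. An affine semigroup is a finitely generated submonoid $S$ of $\mathbb{Z}^d$ such that the group generated by $S$ is $\mathbb{Z}^d$; it is pointed if $S\cap(-S)=\{0\}$. $S_w\subset\mathbb{Z}^{d+1}$ is the submonoid generated by $\mathcal{A}_w=\{(a_1,w_1),\ldots,(a_n,w_n),(0,\ldots,0,1)\}$. Betti elements: let $\mathcal{A}=\{a_1,\ldots,a_n\}$, $\pi_{\mathcal{A}}:\mathbb{N}^n\to\mathbb{Z}^d$, $u\mapsto u_1a_1+\cdots+u_na_n$, and let $\sim_{\mathcal{A}}$ be its kernel congruence. A minimal presentation of $S$ is a minimal system of generators $\rho\subset\mathbb{N}^n\times\mathbb{N}^n$ of $\sim_{\mathcal{A}}$ (equivalently, a minimal set of binomial generators $x^\alpha-x^\beta$ of the toric ideal $I_{\mathcal{A}}=\langle x^u-x^v\mid\pi_{\mathcal{A}}(u)=\pi_{\mathcal{A}}(v)\rangle$). $\operatorname{Betti}(S):=\{\pi_{\mathcal{A}}(\alpha)\mid(\alpha,\beta)\in\rho\}$ for any minimal presentation $\rho$ (independent of $\rho$); $\operatorname{Betti}(S_w)$ is defined in the same way using $\mathcal{A}_w$. Möbius function: for a pointed affine semigroup $T\subset\mathbb{Z}^k$, order $\mathbb{Z}^k$ by $x\leq_Ty$ iff $y-x\in T$ (and $x<_Ty$ if moreover $x\ne y$). Let $c_l(0,y)$ be the number of chains $0<_Tz_1<_T\cdots<_Tz_l=y$ of length $l$ in $\mathbb{Z}^k$ (so $c_0(0,y)=1$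 if $y=0$ and $0$ otherwise). The Möbius function of $T$ is $\mu_T(y):=\sum_{l\geq0}(-1)^lc_l(0,y)$, a finite sum.
   Formalization: The generators a_1,…,a_n are assumed nonzero; if some a_i = 0 then b = 0, so k_A is not determined and the formula can fail (e.g. d=1, a=(1,0), w=(0,2) at (z,λ)=(0,2)). *)

theory Defs
  imports "HOL-Analysis.Analysis" "HOL-Computational_Algebra.Group_Closure"
begin

text \<open>
  The group \<open>\<int>\<^sup>k\<close> is the type \<open>int ^ 'k\<close> with \<open>k = CARD('k)\<close>.  Generators \<open>a\<^sub>1, \<dots>, a\<^sub>n\<close> are a
  family \<open>a :: 'n \<Rightarrow> int ^ 'k\<close> with \<open>n = CARD('n)\<close>, and \<open>\<nat>\<^sup>n\<close> is \<open>nat ^ 'n\<close>.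
  The types \<open>'k option\<close> and \<open>'n option\<close> play the role of the index sets \<open>{1..k+1}\<close>
  and \<open>{1..n+1}\<close>, with \<open>None\<close> as the last index.
\<close>

subsection \<open>Affine semigroups\<close>

definition submonoid :: "'a::comm_monoid_add set \<Rightarrow> bool" where
  "submonoid M \<longleftrightarrow> 0 \<in> M \<and> (\<forall>x\<in>M. \<forall>y\<in>M. x + y \<in> M)"

definition monoid_gen :: "('n \<Rightarrow> int ^ 'k::finite) \<Rightarrow> (int ^ 'k) set" where
  "monoid_gen a = submonoid hull (range a)"

definition affine_semigroup :: "(int ^ 'k::finite) set \<Rightarrow> bool" where
  "affine_semigroup S \<longleftrightarrow>
     (\<exists>G. finite G \<and> S = submonoid hull G) \<and> group_closure S = UNIV"

definition pointed :: "(int ^ 'k::finite) set \<Rightarrow> bool" where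
  "pointed S \<longleftrightarrow> S \<inter> uminus ` S = {0}"

subsection \<open>Minimal presentations and Betti elements\<close>

definition factor_map :: "('n::finite \<Rightarrow> int ^ 'k::finite) \<Rightarrow> nat ^ 'n \<Rightarrow> int ^ 'k" where
  "factor_map a u = (\<Sum>i\<in>UNIV. int (u $ i) *s a i)"

definition kernel_congruence ::
    "('n::finite \<Rightarrow> int ^ 'k::finite) \<Rightarrow> ((nat ^ 'n) \<times> (nat ^ 'n)) set" where
  "kernel_congruence a = {(u, v). factor_map a u = factor_map a v}"

definition congruence :: "('m::comm_monoid_add \<times> 'm) set \<Rightarrow> bool" where
  "congruence R \<longleftrightarrow> equiv UNIV R \<and> (\<forall>u v t. (u, v) \<in> R \<longrightarrow> (u + t, v + t) \<in> R)"

definition minimal_presentation ::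
    "('n::finite \<Rightarrow> int ^ 'k::finite) \<Rightarrow> ((nat ^ 'n) \<times> (nat ^ 'n)) set \<Rightarrow> bool" where
  "minimal_presentation a \<rho> \<longleftrightarrow>
     congruence hull \<rho> = kernel_congruence a \<and>
     (\<forall>\<rho>'. \<rho>' \<subset> \<rho> \<longrightarrow> congruence hull \<rho>' \<noteq> kernel_congruence a)"

text \<open>
  For nonzero generators of a pointed semigroup, every minimal presentation yields the same set
  of Betti elements, so the union over all minimal presentations below is the set obtained
  from any single one of them.
\<close>

definition Betti :: "('n::finite \<Rightarrow> int ^ 'k::finite) \<Rightarrow> (int ^ 'k) set" where
  "Betti a = {factor_map a \<alpha> | \<alpha> \<beta> \<rho>. minimal_presentation a \<rho> \<and> (\<alpha>, \<beta>) \<in> \<rho>}"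

subsection \<open>The generators of \<open>S\<^sub>w\<close>\<close>

definition snoc_vec :: "int ^ 'k::finite \<Rightarrow> int \<Rightarrow> int ^ ('k option)" where
  "snoc_vec z l = (\<chi> i. case i of Some j \<Rightarrow> z $ j | None \<Rightarrow> l)"

definition lift_gens ::
    "('n \<Rightarrow> int ^ 'k::finite) \<Rightarrow> ('n \<Rightarrow> nat) \<Rightarrow> 'n option \<Rightarrow> int ^ ('k option)" where
  "lift_gens a w i = (case i of Some j \<Rightarrow> snoc_vec (a j) (int (w j)) | None \<Rightarrow> snoc_vec 0 1)"

subsection \<open>The Moebius function\<close>

definition less_by :: "(int ^ 'k::finite) set \<Rightarrow> int ^ 'k \<Rightarrow> int ^ 'k \<Rightarrow> bool" where
  "less_by T x y \<longleftrightarrow> y - x \<in> T \<and> x \<noteq> y"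

text \<open>The chain \<open>0 < z\<^sub>1 < \<dots> < z\<^sub>l = y\<close> is encoded by the list \<open>[z\<^sub>1, \<dots>, z\<^sub>l]\<close>.\<close>

definition chains :: "(int ^ 'k::finite) set \<Rightarrow> nat \<Rightarrow> int ^ 'k \<Rightarrow> (int ^ 'k) list set" where
  "chains T l y =
     {zs. length zs = l \<and> successively (less_by T) (0 # zs) \<and> last (0 # zs) = y}"

text \<open>
  For a pointed affine semigroup all sets of chains to a given \<open>y\<close> are finite and only finitely
  many of them are nonempty, so neither \<open>card\<close> nor the sum takes its default value.
\<close>

definition moebius_fun :: "(int ^ 'k::finite) set \<Rightarrow> int ^ 'k \<Rightarrow> int" where
  "moebius_fun T y = (\<Sum>l | card (chains T l y) \<noteq> 0. (-1) ^ l * int (card (chains T l y)))"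

subsection \<open>The subsets \<open>A\<close> with \<open>z = (\<Sum>i\<in>A. a\<^sub>i) + k\<^sub>A b\<close>\<close>

definition frak_a ::
    "('n::finite \<Rightarrow> int ^ 'k::finite) \<Rightarrow> int ^ 'k \<Rightarrow> int ^ 'k \<Rightarrow> 'n set set" where
  "frak_a a b z = {A. \<exists>k::nat. z = (\<Sum>i\<in>A. a i) + int k *s b}"

end

theory Submission
  imports Defs
begin

text \<open>
  If a relation between distinct factorizations exists in degree \<open>y\<close>, then every factorization of
  \<open>y\<close> dominates one of the Betti element \<open>\<beta>\<close>; in particular the factorizations
  \<open>\<alpha>\<^sub>0, \<dots>, \<alpha>\<^sub>r\<close> of \<open>\<beta>\<close> have pairwise disjoint supports.  Hence the number \<open>p(y)\<close> of
  factorizations of \<open>y\<close> is \<open>\<Sum>\<^sub>k (k + r - 1 choose k) [y - k \<beta> \<in> T]\<close>, while inclusion-exclusion over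
  supports gives \<open>\<Sum>\<^sub>A (-1)\<^bsup>|A|\<^esup> p(y - \<Sum>\<^sub>i\<^sub>\<in>\<^sub>A g\<^sub>i) = [y = 0]\<close>.  Combining the two exhibits the signed sum over the
  pairs \<open>(A, k)\<close> with \<open>y = \<Sum>\<^sub>i\<^sub>\<in>\<^sub>A g\<^sub>i + k \<beta>\<close> as the convolution inverse of the indicator function of \<open>T\<close>, which is the Moebius function.
  Dropping one generator from the support of each of \<open>\<alpha>\<^sub>1, \<dots>, \<alpha>\<^sub>r\<close> leaves a basis of the rational
  vector space spanned by \<open>T\<close>, so \<open>r\<close> is the number of generators minus the dimension.  All this is
  applied to \<open>T = S\<^sub>w\<close>, and the sets \<open>A\<close> are split by whether they contain the last generator.
\<close>

subsection \<open>Dickson's lemma\<close>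

text \<open>Every sequence has a monotone subsequence. A weakly decreasing one in \<open>nat\<close>
  is constant once its least value is attained, so from there on it is weakly increasing
  too.\<close>

lemma nat_mono_subseq:
  fixes s :: "nat \<Rightarrow> nat"
  obtains f :: "nat \<Rightarrow> nat" where "strict_mono f" "mono (s \<circ> f)"
proof -
  obtain f :: "nat \<Rightarrow> nat" where f: "strict_mono f" "monoseq (\<lambda>n. s (f n))"
    using seq_monosub[of s] by auto
  show thesis
  proof (cases "\<forall>m n. m \<le> n \<longrightarrow> s (f m) \<le> s (f n)")
    case True
    then show ?thesis using f that[of f] by (auto simp: mono_def)
  next
    case False
    then have dec: "s (f n) \<le> s (f m)" if "m \<le> n" for m n
      using f(2) that unfolding monoseq_def by blast
    obtain N where N: "\<And>n. s (f N) \<le> s (f n)"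
      using ex_has_least_nat[of "\<lambda>_. True" _ "\<lambda>n. s (f n)"] by auto
    have "s (f (N + j)) = s (f N)" for j
      using N[of "N + j"] dec[of N "N + j"] by simp
    then have "mono (s \<circ> (\<lambda>j. f (N + j)))" by (simp add: mono_def)
    moreover have "strict_mono (\<lambda>j. f (N + j))" using f(1) by (simp add: strict_mono_def)
    ultimately show ?thesis using that by blast
  qed
qed

text \<open>One coordinate at a time: a further subsequence keeps the coordinates already treated
  monotone.\<close>

lemma vec_mono_subseq:
  fixes x :: "nat \<Rightarrow> nat ^ 'n::finite"
  obtains r :: "nat \<Rightarrow> nat" where "strict_mono r" "mono (x \<circ> r)"
proof -
  have "\<exists>r :: nat \<Rightarrow> nat. strict_mono r \<and> (\<forall>i\<in>I. mono (\<lambda>j. x (r j) $ i))" for I :: "'n set"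
    using finite[of I]
  proof induction
    case empty
    show ?case by (rule exI[of _ id]) (auto simp: strict_mono_def)
  next
    case (insert i I)
    then obtain r :: "nat \<Rightarrow> nat" where r: "strict_mono r" "\<forall>i\<in>I. mono (\<lambda>j. x (r j) $ i)" by blast
    obtain f :: "nat \<Rightarrow> nat" where f: "strict_mono f" "mono ((\<lambda>j. x (r j) $ i) \<circ> f)"
      by (rule nat_mono_subseq)
    have "strict_mono (r \<circ> f)" using r f by (auto simp: strict_mono_def)
    moreover have "\<forall>i'\<in>insert i I. mono (\<lambda>j. x ((r \<circ> f) j) $ i')"
      using r(2) f(2) strict_mono_mono[OF f(1)] by (auto simp: mono_def)
    ultimately show ?case by blast
  qed
  from this[of UNIV] that show thesis
    by (auto simp: mono_def less_eq_vec_def)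
qed

text \<open>A monotone subsequence of an injective sequence in \<open>U\<close> supplies the
  comparable pair.\<close>

lemma dickson:
  fixes U :: "(nat ^ 'n::finite) set"
  assumes "infinite U"
  obtains u v where "u \<in> U" "v \<in> U" "u \<le> v" "u \<noteq> v"
proof -
  obtain x :: "nat \<Rightarrow> nat ^ 'n" where x: "inj x" "range x \<subseteq> U"
    using infinite_countable_subset[OF assms] by blast
  obtain r :: "nat \<Rightarrow> nat" where r: "strict_mono r" "mono (x \<circ> r)" by (rule vec_mono_subseq)
  have "r 0 < r 1" using r(1) by (simp add: strict_mono_def)
  then have "x (r 0) \<noteq> x (r 1)" using x(1) by (metis injD less_irrefl)
  moreover have "x (r 0) \<le> x (r 1)" using r(2) by (auto simp: mono_def)
  ultimately show thesis using that x(2) by blast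
qed

subsection \<open>The Moebius function of a poset with finite intervals\<close>

text \<open>What the recursion for the Moebius function needs: \<open>sub\<close> and
  \<open>antisym\<close> make the relation given by \<open>T\<close> a partial order,
  \<open>fin\<close> makes its intervals finite.\<close>

locale pointed_monoid =
  fixes T :: "(int ^ 'k::finite) set"
  assumes sub: "submonoid T"
    and antisym: "\<And>x. x \<in> T \<Longrightarrow> - x \<in> T \<Longrightarrow> x = 0"
    and fin: "\<And>y. finite {x \<in> T. y - x \<in> T}"
begin

abbreviation "interval y \<equiv> {x \<in> T. y - x \<in> T}"

lemma zero_mem: "0 \<in> T" and add_mem: "x \<in> T \<Longrightarrow> y \<in> T \<Longrightarrow> x + y \<in> T"
  using sub by (auto simp: submonoid_def)

lemma chains_0: "chains T 0 y = (if y = 0 then {[]} else {})"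
  by (auto simp: chains_def)

lemma chains_Suc:
  "chains T (Suc l) y = (\<Union>x\<in>{x. less_by T x y}. (\<lambda>zs. zs @ [y]) ` chains T l x)" (is "?L = ?R")
proof
  show "?L \<subseteq> ?R"
  proof
    fix ws assume ws: "ws \<in> ?L"
    then obtain zs q where eq: "ws = zs @ [q]"
      unfolding chains_def by (cases ws rule: rev_cases) auto
    with ws have q: "q = y" and len: "length zs = l" and s: "successively (less_by T) ((0 # zs) @ [y])"
      by (auto simp: chains_def)
    have "successively (less_by T) (0 # zs)" "less_by T (last (0 # zs)) y"
      using s by (auto simp only: successively_append_iff) auto
    then have "zs \<in> chains T l (last (0 # zs))" "last (0 # zs) \<in> {x. less_by T x y}"
      using len by (auto simp: chains_def)
    then show "ws \<in> ?R" unfolding eq q by blast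
  qed
  show "?R \<subseteq> ?L"
  proof
    fix ws assume "ws \<in> ?R"
    then obtain x zs where x: "less_by T x y" "zs \<in> chains T l x" "ws = zs @ [y]" by auto
    then have "successively (less_by T) ((0 # zs) @ [y])"
      by (auto simp only: successively_append_iff chains_def) auto
    then show "ws \<in> ?L" using x by (auto simp: chains_def)
  qed
qed

lemma chains_outside: "y \<notin> T \<Longrightarrow> chains T l y = {}"
proof (induction l arbitrary: y)
  case 0
  then show ?case using zero_mem by (auto simp: chains_0)
next
  case (Suc l)
  have "chains T l x = {}" if "less_by T x y" for x
    using Suc that add_mem[of x "y - x"] by (auto simp: less_by_def)
  then show ?case by (simp add: chains_Suc)
qed

text \<open>\<open>less_by\<close> also relates points outside \<open>T\<close> to \<open>y\<close>,
  possibly infinitely many. No chain starting at 0 visits them, so only this finite part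
  matters.\<close>

definition below where "below y = interval y - {y}"

lemma finite_below: "finite (below y)"
  using fin by (simp add: below_def)

lemma chains_Suc_below:
  "chains T (Suc l) y = (\<Union>x\<in>below y. (\<lambda>zs. zs @ [y]) ` chains T l x)"
proof -
  have "(\<Union>x\<in>{x. less_by T x y}. (\<lambda>zs. zs @ [y]) ` chains T l x) =
        (\<Union>x\<in>below y. (\<lambda>zs. zs @ [y]) ` chains T l x)"
    using chains_outside[of _ l] by (auto simp: less_by_def below_def)
  then show ?thesis by (simp add: chains_Suc)
qed

lemma finite_chains: "finite (chains T l y)"
  by (induction l arbitrary: y) (auto simp: chains_0 chains_Suc_below finite_below)

lemma card_chains_Suc: "card (chains T (Suc l) y) = (\<Sum>x\<in>below y. card (chains T l x))"
proof -
  \<comment> \<open>A chain determines its endpoint, so the sets united in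
    \<open>chains_Suc_below\<close> are pairwise disjoint.\<close>
  have "x = x'" if "zs \<in> chains T l x" "zs \<in> chains T l x'" for zs x x'
    using that by (simp add: chains_def)
  then have "\<forall>x\<in>below y. \<forall>x'\<in>below y. x \<noteq> x' \<longrightarrow>
      (\<lambda>zs. zs @ [y]) ` chains T l x \<inter> (\<lambda>zs. zs @ [y]) ` chains T l x' = {}"
    by blast
  then have "card (chains T (Suc l) y) = (\<Sum>x\<in>below y. card ((\<lambda>zs. zs @ [y]) ` chains T l x))"
    unfolding chains_Suc_below
    by (intro card_UN_disjoint finite_below ballI finite_imageI finite_chains) blast
  also have "\<dots> = (\<Sum>x\<in>below y. card (chains T l x))"
    by (intro sum.cong refl card_image) (simp add: inj_on_def)
  finally show ?thesis .
qed

text \<open>The measure for the later inductions: by transitivity going strictly down gains nothing,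
  and it loses the top element \<open>y\<close>.\<close>

lemma card_interval_below:
  assumes "x \<in> below y" shows "card (interval x) < card (interval y)"
proof (rule psubset_card_mono[OF fin])
  have x: "x \<in> T" "y - x \<in> T" "x \<noteq> y" using assms by (auto simp: below_def)
  have "interval x \<subseteq> interval y"
    using add_mem[of "x - _" "y - x"] x by auto
  moreover have "y \<in> interval y" using add_mem[of x "y - x"] x zero_mem by auto
  moreover have "y \<notin> interval x" using antisym[of "y - x"] x by auto
  ultimately show "interval x \<subset> interval y" by blast
qed

text \<open>Intervals shrink strictly along a chain; equivalently, a chain of length
  \<open>l\<close> together with 0 occupies \<open>l + 1\<close> elements of
  \<open>interval y\<close>.\<close>

lemma chains_long: "card (interval y) \<le> l \<Longrightarrow> card (chains T l y) = 0"
proof (induction l arbitrary: y)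
  case 0
  then have "interval y = {}" using fin[of y] by simp
  then have "y \<notin> T" using zero_mem by auto
  then show ?case using chains_outside by simp
next
  case (Suc l)
  have "card (chains T l x) = 0" if "x \<in> below y" for x
    using Suc card_interval_below[OF that] by simp
  then show ?case by (simp add: card_chains_Suc del: card_eq_0_iff)
qed

text \<open>The bound \<open>N\<close> is left free so that a single one serves \<open>y\<close> and
  everything below it in \<open>moebius_fun_rec\<close>.\<close>

lemma moebius_fun_eq:
  assumes "card (interval y) \<le> N"
  shows "moebius_fun T y = (\<Sum>l<N. (-1) ^ l * int (card (chains T l y)))"
  unfolding moebius_fun_def
proof (rule sum.mono_neutral_left)
  show "{l. card (chains T l y) \<noteq> 0} \<subseteq> {..<N}"
  proof
    fix l assume "l \<in> {l. card (chains T l y) \<noteq> 0}"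
    then show "l \<in> {..<N}" using chains_long[of y l] assms by (cases "l < N") auto
  qed
qed auto

lemma moebius_fun_outside: "y \<notin> T \<Longrightarrow> moebius_fun T y = 0"
  using chains_outside[of y] by (simp add: moebius_fun_def)

text \<open>Removing the top of a chain lowers its length by one and flips its sign; the chain of
  length zero gives the delta term.\<close>

lemma moebius_fun_rec:
  "moebius_fun T y = (if y = 0 then 1 else 0) - (\<Sum>x\<in>below y. moebius_fun T x)"
proof -
  let ?N = "card (interval y)"
  have "moebius_fun T y = (\<Sum>l<Suc ?N. (-1) ^ l * int (card (chains T l y)))"
    by (rule moebius_fun_eq) simp
  also have "\<dots> = int (card (chains T 0 y)) +
      (\<Sum>l<?N. (-1) ^ Suc l * int (card (chains T (Suc l) y)))"
    by (subst sum.lessThan_Suc_shift) simp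
  also have "(\<Sum>l<?N. (-1) ^ Suc l * int (card (chains T (Suc l) y))) =
      - (\<Sum>l<?N. \<Sum>x\<in>below y. (-1) ^ l * int (card (chains T l x)))"
    by (simp add: card_chains_Suc sum_distrib_left sum_negf)
  also have "(\<Sum>l<?N. \<Sum>x\<in>below y. (-1) ^ l * int (card (chains T l x))) =
      (\<Sum>x\<in>below y. \<Sum>l<?N. (-1) ^ l * int (card (chains T l x)))"
    by (rule sum.swap)
  also have "\<dots> = (\<Sum>x\<in>below y. moebius_fun T x)"
    by (intro sum.cong refl moebius_fun_eq[symmetric] less_imp_le card_interval_below)
  finally show ?thesis by (simp add: chains_0)
qed

text \<open>The hypotheses say that \<open>F\<close> is a convolution inverse of the indicator
  function of \<open>T\<close>. They determine \<open>F y\<close> from the values strictly below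
  \<open>y\<close>, by the same recursion as \<open>moebius_fun_rec\<close>.\<close>

lemma moebius_fun_unique:
  fixes F :: "int ^ 'k \<Rightarrow> int"
  assumes outside: "\<And>y. y \<notin> T \<Longrightarrow> F y = 0"
    and conv: "\<And>y. y \<in> T \<Longrightarrow> (\<Sum>x\<in>interval y. F x) = (if y = 0 then 1 else 0)"
  shows "moebius_fun T y = F y"
proof (induction "card (interval y)" arbitrary: y rule: less_induct)
  case less
  show ?case
  proof (cases "y \<in> T")
    case True
    then have "y \<in> interval y" using zero_mem by auto
    then have "(\<Sum>x\<in>interval y. F x) = F y + (\<Sum>x\<in>below y. F x)"
      unfolding below_def by (rule sum.remove[OF fin])
    moreover have "(\<Sum>x\<in>below y. moebius_fun T x) = (\<Sum>x\<in>below y. F x)"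
      by (intro sum.cong refl less card_interval_below)
    ultimately show ?thesis using moebius_fun_rec[of y] conv[OF True] by simp
  qed (simp add: outside moebius_fun_outside)
qed

end

subsection \<open>Factorizations\<close>

lemma factor_map_add: "factor_map g (u + v) = factor_map g u + factor_map g v"
  by (simp add: factor_map_def vector_sadd_rdistrib sum.distrib)

lemma factor_map_0 [simp]: "factor_map g 0 = 0"
  by (simp add: factor_map_def)

lemma factor_map_indicator:
  "factor_map g (\<chi> i. if i \<in> A then 1 else 0) = (\<Sum>i\<in>A. g i)"
proof -
  have "factor_map g (\<chi> i. if i \<in> A then 1 else 0) = (\<Sum>i\<in>UNIV. if i \<in> A then g i else 0)"
    unfolding factor_map_def by (rule sum.cong) auto
  then show ?thesis by (simp add: sum.If_cases)
qed

lemma factor_map_axis: "factor_map g (axis i 1) = g i"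
proof -
  have "axis i (1 :: nat) = (\<chi> j. if j \<in> {i} then 1 else 0)"
    by (auto simp: axis_def vec_eq_iff)
  then show ?thesis using factor_map_indicator[of g "{i}"] by simp
qed

text \<open>Reads the componentwise order as divisibility of monomials, so that a dominated
  factorization can be split off.\<close>

lemma nat_vec_le_iff_add: "u \<le> v \<longleftrightarrow> (\<exists>t. v = u + t)" for u v :: "nat ^ 'n::finite"
proof
  assume "u \<le> v"
  then have "v = u + (\<chi> i. v $ i - u $ i)"
    by (simp add: vec_eq_iff less_eq_vec_def)
  then show "\<exists>t. v = u + t" ..
qed (auto simp: less_eq_vec_def)

lemma finite_nat_vec_atMost: "finite {u :: nat ^ 'n::finite. u \<le> v}"
proof (rule finite_subset)
  show "{u. u \<le> v} \<subseteq> vec_lambda ` (UNIV \<rightarrow>\<^sub>E {..Max (range (vec_nth v))})"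
  proof
    fix u :: "nat ^ 'n" assume "u \<in> {u. u \<le> v}"
    then have "u $ i \<le> v $ i" for i by (simp add: less_eq_vec_def)
    then have "u $ i \<le> Max (range (vec_nth v))" for i
      by (rule order_trans) simp
    then have "vec_nth u \<in> UNIV \<rightarrow>\<^sub>E {..Max (range (vec_nth v))}" by auto
    moreover have "u = vec_lambda (vec_nth u)" by simp
    ultimately show "u \<in> vec_lambda ` (UNIV \<rightarrow>\<^sub>E {..Max (range (vec_nth v))})" by (rule rev_image_eqI[where f = vec_lambda])
  qed
  show "finite (vec_lambda ` ((UNIV :: 'n set) \<rightarrow>\<^sub>E {..Max (range (vec_nth v))}))"
    by (intro finite_imageI finite_PiE) auto
qed

lemma submonoid_range_factor_map: "submonoid (range (factor_map g))"
  unfolding submonoid_def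
proof (intro conjI ballI)
  show "0 \<in> range (factor_map g)" by (rule range_eqI[of _ _ 0]) simp
next
  fix x y assume "x \<in> range (factor_map g)" "y \<in> range (factor_map g)"
  then obtain u v where "x = factor_map g u" "y = factor_map g v" by blast
  then show "x + y \<in> range (factor_map g)"
    by (intro range_eqI[of _ _ "u + v"]) (simp add: factor_map_add)
qed

lemma monoid_gen_eq_range:
  fixes g :: "'n::finite \<Rightarrow> int ^ 'k::finite"
  shows "monoid_gen g = range (factor_map g)"
  unfolding monoid_gen_def
proof (rule hull_unique)
  show "range g \<subseteq> range (factor_map g)"
    using factor_map_axis[of g] by (metis image_subsetI rangeI)
  show "submonoid (range (factor_map g))"
    by (rule submonoid_range_factor_map)
next
  fix M assume M: "range g \<subseteq> M" "submonoid M"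
  have mult: "int c *s g i \<in> M" for c i
    using M by (induction c) (auto simp: submonoid_def vector_sadd_rdistrib)
  have "(\<Sum>i\<in>I. int (u $ i) *s g i) \<in> M" for u :: "nat ^ 'n" and I
    using finite[of I] by induction (use M(2) mult in \<open>auto simp: submonoid_def\<close>)
  then show "range (factor_map g) \<subseteq> M" by (auto simp: factor_map_def)
qed

text \<open>Expansion of the product of the factors \<open>1 - 1\<close> over
  \<open>B\<close>.\<close>

lemma alternating_sum_Pow:
  assumes "finite B"
  shows "(\<Sum>A\<in>Pow B. (-1) ^ card A) = (if B = {} then 1 else 0 :: int)"
  using prod_diff_conv_sum[OF assms, of "\<lambda>_. 1 :: int" "\<lambda>_. 1"] assms
  by (auto simp: power_0_left)

text \<open>The hockey-stick identity along a diagonal of Pascal's triangle.\<close>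

lemma sum_choose_truncated:
  assumes "0 < r"
  shows "(\<Sum>k\<le>K. (k + r - 1) choose k) = (r + K) choose K"
  using sum_choose_lower[of "r - 1" K] assms by (simp add: add.commute)

text \<open>Pointedness and nonzero generators enter the argument in this form, supplied by
  \<open>faithful_gens_of_pointed\<close>.\<close>

locale faithful_gens =
  fixes g :: "'m::finite \<Rightarrow> int ^ 'k::finite"
  assumes faithful: "\<And>u. factor_map g u = 0 \<Longrightarrow> u = 0"
begin

abbreviation "deg \<equiv> factor_map g"
abbreviation "fiber y \<equiv> {u. deg u = y}"
abbreviation "T \<equiv> monoid_gen g"

lemma mem_T_iff: "y \<in> T \<longleftrightarrow> fiber y \<noteq> {}"
  by (auto simp: monoid_gen_eq_range)

text \<open>By Dickson's lemma an infinite fiber contains two comparable elements, whose difference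
  is a nontrivial factorization of 0.\<close>

lemma finite_fiber: "finite (fiber y)"
proof (rule ccontr)
  assume "infinite (fiber y)"
  then obtain u v where uv: "u \<in> fiber y" "v \<in> fiber y" "u \<le> v" "u \<noteq> v"
    by (rule dickson)
  obtain t where t: "v = u + t" using uv(3) unfolding nat_vec_le_iff_add ..
  have "deg t = 0" using uv(1,2) t by (simp add: factor_map_add)
  then show False using faithful[of t] uv(4) t by simp
qed

lemma nat_vec_add_eq_0_iff: "u + v = 0 \<longleftrightarrow> u = 0 \<and> v = 0" for u v :: "nat ^ 'm"
  by (auto simp: vec_eq_iff)

sublocale pointed_monoid T
proof
  show "submonoid T"
    unfolding monoid_gen_eq_range by (rule submonoid_range_factor_map)
next
  fix x assume "x \<in> T" "- x \<in> T"
  then obtain u v where "x = deg u" "- x = deg v" by (auto simp: monoid_gen_eq_range)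
  then have "deg (u + v) = 0" by (metis add.right_inverse factor_map_add)
  then have "u = 0" using faithful[of "u + v"] nat_vec_add_eq_0_iff by blast
  then show "x = 0" using \<open>x = deg u\<close> by simp
next
  fix y
  \<comment> \<open>Factorizations of \<open>x\<close> and of \<open>y - x\<close> add up to one of
    \<open>y\<close>, so \<open>x\<close> is the degree of a vector below some element of the finite
    \<open>fiber y\<close>.\<close>
  have "{x \<in> T. y - x \<in> T} \<subseteq> deg ` (\<Union>w\<in>fiber y. {u. u \<le> w})"
  proof
    fix x assume "x \<in> {x \<in> T. y - x \<in> T}"
    then obtain u v where uv: "x = deg u" "y - x = deg v" by (auto simp: monoid_gen_eq_range)
    then have "deg (u + v) = y" by (simp add: factor_map_add flip: uv)
    moreover have "u \<le> u + v" by (auto simp: nat_vec_le_iff_add)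
    ultimately show "x \<in> deg ` (\<Union>w\<in>fiber y. {u. u \<le> w})" using uv(1) by blast
  qed
  then show "finite {x \<in> T. y - x \<in> T}"
    by (rule finite_subset) (intro finite_imageI finite_UN_I finite_fiber finite_nat_vec_atMost)
qed

text \<open>Adding the indicator vector of \<open>A\<close> is the bijection.\<close>

lemma card_fiber_shift:
  "card (fiber (y - (\<Sum>i\<in>A. g i))) = card {u \<in> fiber y. A \<subseteq> {i. u $ i \<noteq> 0}}"
proof (rule bij_betw_same_card)
  let ?c = "(\<chi> i. if i \<in> A then 1 else 0) :: nat ^ 'm"
  show "bij_betw (\<lambda>u. u + ?c) (fiber (y - (\<Sum>i\<in>A. g i))) {u \<in> fiber y. A \<subseteq> {i. u $ i \<noteq> 0}}"
  proof (rule bij_betw_imageI)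
    show "inj_on (\<lambda>u. u + ?c) (fiber (y - (\<Sum>i\<in>A. g i)))" by (simp add: inj_on_def)
    have "v \<in> (\<lambda>u. u + ?c) ` fiber (y - (\<Sum>i\<in>A. g i))"
      if v: "deg v = y" "A \<subseteq> {i. v $ i \<noteq> 0}" for v
    proof -
      have "?c \<le> v" using v(2) by (auto simp: less_eq_vec_def Suc_le_eq)
      then obtain u where u: "v = u + ?c" by (metis nat_vec_le_iff_add add.commute)
      then have "deg u = y - (\<Sum>i\<in>A. g i)"
        using v(1) by (auto simp: factor_map_add factor_map_indicator)
      then show ?thesis using u by blast
    qed
    then show "(\<lambda>u. u + ?c) ` fiber (y - (\<Sum>i\<in>A. g i)) = {u \<in> fiber y. A \<subseteq> {i. u $ i \<noteq> 0}}"
      by (auto simp: factor_map_add factor_map_indicator)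
  qed
qed

text \<open>After exchanging the sums, each factorization \<open>u\<close> contributes the
  alternating sum over the subsets of its support, which vanishes unless \<open>u = 0\<close>. In
  generating functions: the product of all \<open>1 - t^(g i)\<close> inverts the series counting
  factorizations.\<close>

lemma alternating_sum_card_fiber:
  "(\<Sum>A\<in>UNIV. (-1) ^ card A * int (card (fiber (y - (\<Sum>i\<in>A. g i))))) = (if y = 0 then 1 else 0)"
proof -
  let ?s = "\<lambda>u :: nat ^ 'm. {i. u $ i \<noteq> 0}"
  have "int (card (fiber (y - (\<Sum>i\<in>A. g i)))) = (\<Sum>u\<in>fiber y. if A \<subseteq> ?s u then 1 else 0)" for A
    unfolding card_fiber_shift using finite_fiber[of y]
    by (simp add: sum.If_cases Collect_conj_eq)
  then have "(\<Sum>A\<in>UNIV. (-1) ^ card A * int (card (fiber (y - (\<Sum>i\<in>A. g i))))) =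
      (\<Sum>A\<in>UNIV. \<Sum>u\<in>fiber y. if A \<subseteq> ?s u then (-1) ^ card A else 0)"
    by (simp add: sum_distrib_left if_distrib cong: if_cong)
  also have "\<dots> = (\<Sum>u\<in>fiber y. \<Sum>A\<in>UNIV. if A \<subseteq> ?s u then (-1) ^ card A else 0)"
    by (rule sum.swap)
  also have "\<dots> = (\<Sum>u\<in>fiber y. \<Sum>A\<in>Pow (?s u). (-1) ^ card A)"
    by (simp add: sum.If_cases Pow_def)
  also have "\<dots> = (\<Sum>u\<in>fiber y. if u = 0 then 1 else 0)"
    by (intro sum.cong refl) (auto simp: alternating_sum_Pow vec_eq_iff)
  also have "\<dots> = (if y = 0 then 1 else 0)"
    using finite_fiber[of y] by (auto simp: sum.delta)
  finally show ?thesis .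
qed

end

section \<open>Monoids with a single Betti element\<close>

locale unique_betti = faithful_gens g
  for g :: "'m::finite \<Rightarrow> int ^ 'k::finite" +
  fixes \<beta> :: "int ^ 'k"
  assumes Betti: "Betti g = {\<beta>}"
begin

abbreviation "Z \<equiv> fiber \<beta>"

text \<open>A minimal presentation exists because \<open>Betti g\<close> is nonempty.
  \<open>Betti\<close> records only first components; second components have the same degree since
  the pairs lie in the kernel congruence.\<close>

lemma obtains_presentation:
  obtains \<rho> u v where "congruence hull \<rho> = kernel_congruence g" "(u, v) \<in> \<rho>" "u \<noteq> v"
    "\<And>u v. (u, v) \<in> \<rho> \<Longrightarrow> u \<in> Z \<and> v \<in> Z"
proof -
  obtain \<rho> u v where \<rho>: "minimal_presentation g \<rho>" "(u, v) \<in> \<rho>"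
    using Betti by (auto simp: Betti_def)
  then have hull: "congruence hull \<rho> = kernel_congruence g"
    and minimal: "\<And>\<rho>'. \<rho>' \<subset> \<rho> \<Longrightarrow> congruence hull \<rho>' \<noteq> kernel_congruence g"
    by (auto simp: minimal_presentation_def)
  have "u' \<in> Z \<and> v' \<in> Z" if "(u', v') \<in> \<rho>" for u' v'
  proof -
    have "deg u' \<in> Betti g" unfolding Betti_def using \<rho>(1) that by blast
    moreover have "(u', v') \<in> kernel_congruence g" using that hull hull_subset[of \<rho> congruence] by auto
    ultimately show ?thesis using Betti by (auto simp: kernel_congruence_def)
  qed
  moreover have "u \<noteq> v"
  proof
    assume "u = v"
    \<comment> \<open>Every congruence contains the diagonal, so dropping a trivial pair leaves the
      hull unchanged, against minimality.\<close>
    have "congruence hull \<rho> \<subseteq> congruence hull (\<rho> - {(u, v)})"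
      unfolding hull_def
    proof (intro Inter_anti_mono subsetI CollectI conjI; elim CollectE conjE)
      fix R x assume R: "congruence R" "\<rho> - {(u, v)} \<subseteq> R"
      have "(u, u) \<in> R" using R(1) by (auto simp: congruence_def equiv_def refl_on_def)
      then show "x \<in> R" if "x \<in> \<rho>" for x using R(2) that \<open>u = v\<close> by blast
    qed
    then have "congruence hull (\<rho> - {(u, v)}) = kernel_congruence g"
      using hull_mono[of "\<rho> - {(u, v)}" \<rho> congruence] hull by blast
    moreover have "\<rho> - {(u, v)} \<subset> \<rho>" using \<rho>(2) by blast
    ultimately show False using minimal by blast
  qed
  ultimately show thesis using that hull \<rho>(2) by blast
qed

text \<open>The claim holds for the pairs of a presentation and survives everything that a
  congruence is closed under.\<close>

lemma related_imp_reducible: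
  assumes "deg u = deg v" "u \<noteq> v"
  shows "\<exists>\<alpha>\<in>Z. \<alpha> \<le> u"
proof -
  obtain \<rho> where \<rho>: "congruence hull \<rho> = kernel_congruence g"
    "\<And>u v. (u, v) \<in> \<rho> \<Longrightarrow> u \<in> Z \<and> v \<in> Z"
    by (rule obtains_presentation) blast
  \<comment> \<open>Equality is included to make \<open>R\<close> reflexive; asking for domination
    on both sides makes it symmetric.\<close>
  define R where "R = {(u, v). u = v \<or> deg u = deg v \<and> (\<exists>\<alpha>\<in>Z. \<alpha> \<le> u) \<and> (\<exists>\<alpha>\<in>Z. \<alpha> \<le> v)}"
  have "equiv UNIV R"
    by (rule equivI) (auto simp: R_def refl_on_def sym_def trans_def)
  moreover have "(u + t, v + t) \<in> R" if "(u, v) \<in> R" for u v t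
  proof -
    have "\<alpha> \<le> x \<Longrightarrow> \<alpha> \<le> x + t" for \<alpha> x :: "nat ^ 'm"
      by (auto simp: less_eq_vec_def trans_le_add1)
    then show ?thesis using that by (fastforce simp: R_def factor_map_add)
  qed
  ultimately have "congruence R" by (simp add: congruence_def)
  moreover have "\<rho> \<subseteq> R" using \<rho>(2) by (fastforce simp: R_def)
  ultimately have "kernel_congruence g \<subseteq> R" using \<rho>(1) by (metis hull_minimal)
  then show ?thesis using assms by (auto simp: kernel_congruence_def R_def)
qed

lemma two_factorizations: obtains \<alpha> \<alpha>' where "\<alpha> \<in> Z" "\<alpha>' \<in> Z" "\<alpha> \<noteq> \<alpha>'"
  by (rule obtains_presentation) blast

lemma betti_mem: "\<beta> \<in> T"
  by (rule two_factorizations) (auto simp: mem_T_iff)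

lemma betti_multiple_mem: "int k *s \<beta> \<in> T"
  using zero_mem add_mem betti_mem by (induction k) (auto simp: vector_sadd_rdistrib)

lemma expansion_mem: "(\<Sum>i\<in>A. g i) + int k *s \<beta> \<in> T"
  using factor_map_indicator[of g A] betti_multiple_mem
  by (metis add_mem monoid_gen_eq_range rangeI)

lemma multiple_mem_imp: "y - int k *s \<beta> \<in> T \<Longrightarrow> y \<in> T"
  using add_mem[OF _ betti_multiple_mem[of k]] by fastforce

lemma betti_nonzero: "\<beta> \<noteq> 0"
  by (rule two_factorizations) (use faithful in blast)

lemma Z_nonzero: "\<alpha> \<in> Z \<Longrightarrow> \<alpha> \<noteq> 0"
  using betti_nonzero by auto

text \<open>Cancelling a common generator leaves two distinct factorizations of one element. By
  \<open>related_imp_reducible\<close> one of them dominates a factorization of \<beta>, and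
  comparing degrees yields a nontrivial factorization of 0.\<close>

lemma Z_disjoint_supports:
  assumes "\<alpha> \<in> Z" "\<alpha>' \<in> Z" "\<alpha> \<noteq> \<alpha>'"
  shows "\<alpha> $ i = 0 \<or> \<alpha>' $ i = 0"
proof (rule ccontr)
  have axis_le: "axis i 1 \<le> u" if "u $ i \<noteq> 0" for u :: "nat ^ 'm"
    using that by (auto simp: less_eq_vec_def axis_def)
  assume "\<not> ?thesis"
  then obtain u v where uv: "\<alpha> = axis i 1 + u" "\<alpha>' = axis i 1 + v"
    using axis_le unfolding nat_vec_le_iff_add by blast
  then have "deg u = deg v" "u \<noteq> v" using assms by (auto simp: factor_map_add)
  then obtain \<alpha>'' where "\<alpha>'' \<in> Z" "\<alpha>'' \<le> u" using related_imp_reducible by blast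
  then obtain t where "u = \<alpha>'' + t" by (auto simp: nat_vec_le_iff_add)
  then have "deg (axis i 1 + t) = 0"
    using uv(1) assms(1) \<open>\<alpha>'' \<in> Z\<close> by (auto simp: factor_map_add)
  then have "axis i 1 + t = 0" by (rule faithful)
  then show False by (metis nat_vec_add_eq_0_iff axis_eq_0_iff zero_neq_one)
qed

lemma sum_mset_nth:
  assumes "set_mset M \<subseteq> Z" "\<alpha> \<in> Z" "\<alpha> $ i \<noteq> 0"
  shows "(\<Sum>\<^sub># M) $ i = count M \<alpha> * \<alpha> $ i"
  using assms(1)
proof (induction M)
  case (add x M)
  then show ?case using Z_disjoint_supports[of x \<alpha> i] assms(2,3) by auto
qed auto

text \<open>A coordinate in the support of \<alpha> sees only the copies of \<alpha>, so every
  multiplicity can be read off the sum.\<close>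

lemma inj_on_sum_mset: "inj_on sum_mset {M. set_mset M \<subseteq> Z}"
proof (rule inj_onI, rule multiset_eqI)
  fix M N \<alpha> assume MN: "M \<in> {M. set_mset M \<subseteq> Z}" "N \<in> {M. set_mset M \<subseteq> Z}" "\<Sum>\<^sub># M = \<Sum>\<^sub># N"
  show "count M \<alpha> = count N \<alpha>"
  proof (cases "\<alpha> \<in> Z")
    case True
    then obtain i where i: "\<alpha> $ i \<noteq> 0" using Z_nonzero[of \<alpha>] by (auto simp: vec_eq_iff)
    have "count M \<alpha> * \<alpha> $ i = count N \<alpha> * \<alpha> $ i"
      using sum_mset_nth[OF _ True i, of M] sum_mset_nth[OF _ True i, of N] MN by (metis mem_Collect_eq)
    then show ?thesis using i by simp
  next
    case False
    then show ?thesis using MN by (metis count_eq_zero_iff mem_Collect_eq subsetD)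
  qed
qed

text \<open>\<open>K\<close> is the largest multiple of \<beta> that can be subtracted inside
  \<open>T\<close>, and \<open>\<rho>\<^sub>0\<close> is the unique factorization of what remains.
  The induction subtracts one \<beta> at a time.\<close>

lemma fiber_structure:
  assumes "y \<in> T"
  shows "\<exists>K \<rho>\<^sub>0. (\<forall>k. y - int k *s \<beta> \<in> T \<longleftrightarrow> k \<le> K) \<and>
    fiber y = (\<lambda>M. \<rho>\<^sub>0 + \<Sum>\<^sub># M) ` multisets_of_size Z K"
  using assms
proof (induction "card (interval y)" arbitrary: y rule: less_induct)
  case less
  obtain \<alpha> \<alpha>' where \<alpha>: "\<alpha> \<in> Z" "\<alpha>' \<in> Z" "\<alpha> \<noteq> \<alpha>'" by (rule two_factorizations)
  show ?case
  proof (cases "y - \<beta> \<in> T")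
    case False
    obtain u where u: "deg u = y" using less.prems by (auto simp: mem_T_iff)
    \<comment> \<open>Otherwise \<open>v\<close> would dominate a factorization of \<beta>, which
      puts \<open>y - \<beta>\<close> into \<open>T\<close>.\<close>
    have "v = u" if "deg v = y" for v
    proof (rule ccontr)
      assume "v \<noteq> u"
      moreover have "deg v = deg u" using u that by simp
      ultimately obtain \<alpha>'' where "\<alpha>'' \<in> Z" "\<alpha>'' \<le> v" using related_imp_reducible by blast
      then obtain t where "v = \<alpha>'' + t" by (auto simp: nat_vec_le_iff_add)
      then have "deg t = y - \<beta>" using that \<open>\<alpha>'' \<in> Z\<close> by (auto simp: factor_map_add)
      then show False using False by (auto simp: mem_T_iff)
    qed
    then have "fiber y = {u}" using u by blast
    moreover have "k \<le> 0" if "y - int k *s \<beta> \<in> T" for k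
    proof (cases k)
      case (Suc j)
      have "y - int k *s \<beta> + int j *s \<beta> \<in> T" using that add_mem betti_multiple_mem by blast
      then show ?thesis using False Suc by (simp add: vector_sadd_rdistrib algebra_simps)
    qed simp
    ultimately have "(\<forall>k. y - int k *s \<beta> \<in> T \<longleftrightarrow> k \<le> 0) \<and>
        fiber y = (\<lambda>M. u + \<Sum>\<^sub># M) ` multisets_of_size Z 0"
      using less.prems by auto
    then show ?thesis by blast
  next
    case True
    have "y - \<beta> \<in> below y" using True betti_mem betti_nonzero by (simp add: below_def)
    then obtain K \<rho>\<^sub>0 where K: "\<And>k. y - \<beta> - int k *s \<beta> \<in> T \<longleftrightarrow> k \<le> K"
      and fib: "fiber (y - \<beta>) = (\<lambda>M. \<rho>\<^sub>0 + \<Sum>\<^sub># M) ` multisets_of_size Z K"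
      using less.hyps[OF card_interval_below] True by blast
    have "y - int k *s \<beta> \<in> T \<longleftrightarrow> k \<le> Suc K" for k
    proof (cases k)
      case (Suc j)
      then show ?thesis using K[of j] by (simp add: vector_sadd_rdistrib algebra_simps)
    qed (use less.prems in simp)
    moreover have "fiber y = (\<lambda>M. \<rho>\<^sub>0 + \<Sum>\<^sub># M) ` multisets_of_size Z (Suc K)"
    proof (intro equalityI subsetI)
      fix u assume u: "u \<in> fiber y"
      obtain v where v: "deg v = y - \<beta>" using True by (auto simp: mem_T_iff)
      have "deg (v + \<alpha>) = y" "deg (v + \<alpha>') = y" using v \<alpha> by (auto simp: factor_map_add)
      \<comment> \<open>Since \<beta> has two factorizations, \<open>y\<close> has a factorization
        other than \<open>u\<close>, which makes \<open>u\<close> reducible.\<close>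
      moreover have "u \<noteq> v + \<alpha> \<or> u \<noteq> v + \<alpha>'" using \<alpha>(3) by auto
      ultimately obtain v' where "deg u = deg v'" "u \<noteq> v'"
        using u by (metis mem_Collect_eq)
      then obtain \<alpha>'' where \<alpha>'': "\<alpha>'' \<in> Z" "\<alpha>'' \<le> u" using related_imp_reducible by blast
      then obtain t where t: "u = \<alpha>'' + t" by (auto simp: nat_vec_le_iff_add)
      then have "t \<in> fiber (y - \<beta>)" using u \<alpha>'' by (auto simp: factor_map_add)
      then obtain M where "M \<in> multisets_of_size Z K" "t = \<rho>\<^sub>0 + \<Sum>\<^sub># M" using fib by blast
      then have "add_mset \<alpha>'' M \<in> multisets_of_size Z (Suc K)" "u = \<rho>\<^sub>0 + \<Sum>\<^sub># (add_mset \<alpha>'' M)"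
        using t \<alpha>''(1) by (auto simp: multisets_of_size_def add_ac)
      then show "u \<in> (\<lambda>M. \<rho>\<^sub>0 + \<Sum>\<^sub># M) ` multisets_of_size Z (Suc K)" by blast
    next
      fix u assume "u \<in> (\<lambda>M. \<rho>\<^sub>0 + \<Sum>\<^sub># M) ` multisets_of_size Z (Suc K)"
      then obtain M where M: "set_mset M \<subseteq> Z" "size M = Suc K" "u = \<rho>\<^sub>0 + \<Sum>\<^sub># M"
        by (auto simp: multisets_of_size_def)
      then obtain N \<alpha>'' where N: "M = add_mset \<alpha>'' N" by (metis size_eq_Suc_imp_eq_union)
      then have "N \<in> multisets_of_size Z K" using M by (auto simp: multisets_of_size_def)
      then have "\<rho>\<^sub>0 + \<Sum>\<^sub># N \<in> fiber (y - \<beta>)" using fib by blast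
      then have "deg (\<rho>\<^sub>0 + \<Sum>\<^sub># N) = y - \<beta>" by simp
      then show "u \<in> fiber y" using M N by (auto simp: factor_map_add algebra_simps)
    qed
    ultimately show ?thesis by blast
  qed
qed

section \<open>Counting factorizations and inverting the count\<close>

definition r where "r = card Z - 1"

lemma r_pos: "0 < r"
proof -
  obtain \<alpha> \<alpha>' where \<alpha>: "\<alpha> \<in> Z" "\<alpha>' \<in> Z" "\<alpha> \<noteq> \<alpha>'" by (rule two_factorizations)
  then have "card {\<alpha>, \<alpha>'} \<le> card Z" by (intro card_mono finite_fiber) auto
  then show ?thesis using \<alpha>(3) by (simp add: r_def)
qed

lemma finite_betti_multiples: "finite {k. y - int k *s \<beta> \<in> T}"
proof (cases "y \<in> T")
  case True
  then obtain K where "\<forall>k. y - int k *s \<beta> \<in> T \<longleftrightarrow> k \<le> K" using fiber_structure by blast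
  then show ?thesis by simp
next
  case False
  have "{k. y - int k *s \<beta> \<in> T} = {}" using False multiple_mem_imp by blast
  then show ?thesis by simp
qed

text \<open>Multisets of size \<open>K\<close> from the \<open>r + 1\<close> elements of
  \<open>Z\<close> number \<open>(r + K) choose K\<close>. Written as a sum over \<open>k\<close>,
  the count becomes a convolution with the indicator function of \<open>T\<close>, and this is what
  can be inverted.\<close>

lemma card_fiber:
  "card (fiber y) = (\<Sum>k | y - int k *s \<beta> \<in> T. (k + r - 1) choose k)"
proof (cases "y \<in> T")
  case True
  then obtain K \<rho>\<^sub>0 where K: "\<And>k. y - int k *s \<beta> \<in> T \<longleftrightarrow> k \<le> K"
    and fib: "fiber y = (\<lambda>M. \<rho>\<^sub>0 + \<Sum>\<^sub># M) ` multisets_of_size Z K"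
    using fiber_structure by blast
  have "inj_on (\<lambda>M. \<rho>\<^sub>0 + \<Sum>\<^sub># M) (multisets_of_size Z K)"
    using inj_on_sum_mset by (auto simp: inj_on_def multisets_of_size_def)
  then have "card (fiber y) = (r + K) choose K"
    using r_pos fib by (simp add: card_image card_multisets_of_size finite_fiber r_def)
  also have "\<dots> = (\<Sum>k\<le>K. (k + r - 1) choose k)"
    by (rule sum_choose_truncated[OF r_pos, symmetric])
  finally show ?thesis using K by (simp add: atMost_def)
next
  case False
  have "{k. y - int k *s \<beta> \<in> T} = {}" using False multiple_mem_imp by blast
  then show ?thesis using False by (simp add: mem_T_iff)
qed

definition expansions where
  "expansions y = {(A, k). y = (\<Sum>i\<in>A. g i) + int k *s \<beta>}"

text \<open>Summed over an interval and grouped by \<open>A\<close>, the inner sums over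
  \<open>k\<close> are fiber sizes by \<open>card_fiber\<close>, and inclusion-exclusion leaves the
  delta function.\<close>

lemma moebius_fun_expansions:
  "moebius_fun T y =
     (\<Sum>(A, k)\<in>expansions y. (-1) ^ card A * int ((k + r - 1) choose k))"
proof (rule moebius_fun_unique)
  fix y assume "y \<notin> T"
  have "expansions y = {}" using expansion_mem \<open>y \<notin> T\<close> by (auto simp: expansions_def)
  then show "(\<Sum>(A, k)\<in>expansions y. (-1) ^ card A * int ((k + r - 1) choose k)) = 0" by simp
next
  fix y
  let ?f = "\<lambda>(A :: 'm set, k). (-1) ^ card A * int ((k + r - 1) choose k)"
  let ?S = "SIGMA A:UNIV. {k. y - (\<Sum>i\<in>A. g i) - int k *s \<beta> \<in> T}"
  \<comment> \<open>A pair \<open>(A, k)\<close> determines its own \<open>x\<close>, which lies in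
    \<open>T\<close> by \<open>expansion_mem\<close>; only the condition on \<open>y - x\<close>
    remains.\<close>
  have eq: "?S = (\<Union>x\<in>interval y. expansions x)"
    using expansion_mem by (auto simp: expansions_def diff_diff_eq)
  have fin_S: "finite ?S" using finite_betti_multiples by auto
  have "(\<Sum>x\<in>interval y. \<Sum>p\<in>expansions x. ?f p) = (\<Sum>p\<in>?S. ?f p)"
    unfolding eq
  proof (rule sum.UNION_disjoint[symmetric])
    show "\<forall>x\<in>interval y. finite (expansions x)"
      using fin_S unfolding eq by (meson UN_upper finite_subset)
    show "\<forall>x\<in>interval y. \<forall>x'\<in>interval y. x \<noteq> x' \<longrightarrow> expansions x \<inter> expansions x' = {}"
      by (auto simp: expansions_def)
  qed (rule fin)
  also have "\<dots> = (\<Sum>A\<in>UNIV. \<Sum>k | y - (\<Sum>i\<in>A. g i) - int k *s \<beta> \<in> T.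
      (-1) ^ card A * int ((k + r - 1) choose k))"
    by (rule sum.Sigma[symmetric]) (use finite_betti_multiples in auto)
  also have "\<dots> = (\<Sum>A\<in>UNIV. (-1) ^ card A * int (card (fiber (y - (\<Sum>i\<in>A. g i)))))"
    by (simp add: card_fiber sum_distrib_left)
  also have "\<dots> = (if y = 0 then 1 else 0)" by (rule alternating_sum_card_fiber)
  finally show "(\<Sum>x\<in>interval y. \<Sum>p\<in>expansions x. ?f p) = (if y = 0 then 1 else 0)" .
qed

end

subsection \<open>The number of factorizations of the Betti element\<close>

definition rat_vec :: "int ^ 'k::finite \<Rightarrow> rat ^ 'k" where
  "rat_vec x = (\<chi> i. of_int (x $ i))"

lemma rat_vec_simps:
  "rat_vec (x + y) = rat_vec x + rat_vec y" "rat_vec (c *s x) = of_int c *s rat_vec x"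
  "rat_vec x = rat_vec y \<longleftrightarrow> x = y" "rat_vec 0 = 0"
  by (simp_all add: rat_vec_def vec_eq_iff)

lemma rat_vec_sum: "rat_vec (\<Sum>i\<in>A. f i) = (\<Sum>i\<in>A. rat_vec (f i))"
  by (induction A rule: infinite_finite_induct) (simp_all add: rat_vec_simps)

text \<open>Turns rational relations among generators into integer ones, to which factorizations
  apply.\<close>

lemma common_denominator:
  fixes q :: "'a::finite \<Rightarrow> rat"
  obtains N :: int and c :: "'a \<Rightarrow> int" where "N \<noteq> 0" "\<And>i. of_int (c i) = of_int N * q i"
proof -
  have "\<exists>N c. N \<noteq> 0 \<and> (\<forall>i\<in>I. of_int (c i) = of_int N * q i)" for I
    using finite[of I]
  proof induction
    case empty
    show ?case by (rule exI[of _ 1]) simp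
  next
    case (insert x I)
    then obtain N :: int and c where N: "N \<noteq> 0" "\<forall>i\<in>I. of_int (c i) = of_int N * q i" by blast
    obtain p d where pd: "q x = of_int p / of_int d" "d > 0"
      by (cases "q x") (metis Fract_of_int_quotient)
    define c' where "c' i = (if i = x then N * p else d * c i)" for i
    have "N * d \<noteq> 0" using N pd by simp
    moreover have "\<forall>i\<in>insert x I. of_int (c' i) = of_int (N * d) * q i"
      using N pd by (simp add: c'_def)
    ultimately show ?case by (intro exI conjI)
  qed
  from this[of UNIV] show thesis using that by auto
qed

context unique_betti
begin

text \<open>Each element of \<open>Z\<close> other than \<open>\<alpha>\<^sub>0\<close> receives a
  pivot \<open>j \<alpha>\<close> in its support. The generators off the \<open>r\<close> pivots
  form a basis of the rational space.\<close>

lemma card_gens: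
  assumes "\<And>y. \<exists>c :: 'm \<Rightarrow> int. y = (\<Sum>i\<in>UNIV. c i *s g i)"
  shows "CARD('m) = CARD('k) + r"
proof -
  obtain \<alpha>\<^sub>0 where \<alpha>\<^sub>0: "\<alpha>\<^sub>0 \<in> Z" by (rule two_factorizations)
  define j where "j \<alpha> = (SOME i. \<alpha> $ i \<noteq> 0)" for \<alpha> :: "nat ^ 'm"
  have j: "\<alpha> $ j \<alpha> \<noteq> 0" if "\<alpha> \<in> Z" for \<alpha>
  proof -
    have "\<exists>i. \<alpha> $ i \<noteq> 0" using Z_nonzero[OF that] by (auto simp: vec_eq_iff)
    then show ?thesis unfolding j_def by (rule someI_ex)
  qed
  have j_other: "\<alpha> $ j \<alpha>' = 0" if "\<alpha> \<in> Z" "\<alpha>' \<in> Z" "\<alpha> \<noteq> \<alpha>'" for \<alpha> \<alpha>'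
    using Z_disjoint_supports[OF that, of "j \<alpha>'"] j[OF that(2)] by simp
  define J where "J = j ` (Z - {\<alpha>\<^sub>0})"
  have "inj_on j (Z - {\<alpha>\<^sub>0})"
  proof (rule inj_onI, rule ccontr)
    fix \<alpha> \<alpha>' assume "\<alpha> \<in> Z - {\<alpha>\<^sub>0}" "\<alpha>' \<in> Z - {\<alpha>\<^sub>0}" "j \<alpha> = j \<alpha>'" "\<alpha> \<noteq> \<alpha>'"
    then show False using j[of \<alpha>] j_other[of \<alpha> \<alpha>'] by simp
  qed
  then have card_J: "card J = r"
    using \<alpha>\<^sub>0 finite_fiber[of \<beta>] by (simp add: J_def card_image r_def card_Diff_singleton)
  have \<alpha>\<^sub>0_J: "\<alpha>\<^sub>0 $ i = 0" if "i \<in> J" for i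
  proof -
    obtain \<alpha> where \<alpha>: "\<alpha> \<in> Z" "\<alpha>\<^sub>0 \<noteq> \<alpha>" "i = j \<alpha>" using \<open>i \<in> J\<close> unfolding J_def by blast
    show ?thesis unfolding \<alpha>(3) by (rule j_other[OF \<alpha>\<^sub>0 \<alpha>(1,2)])
  qed
  define G where "G i = rat_vec (g i)" for i

  \<comment> \<open>Clear denominators and split the coefficients into positive and negative parts
    \<open>u\<close> and \<open>v\<close>, two factorizations of the same element.\<close>
  have indep: "q i = 0" if q: "(\<Sum>i\<in>UNIV. q i *s G i) = 0" "\<And>i. i \<in> J \<Longrightarrow> q i = 0" for q i
  proof -
    obtain N c where N: "N \<noteq> 0" "\<And>i. of_int (c i) = of_int N * q i"
      by (rule common_denominator[of q]) blast
    define u v where "u = (\<chi> i. nat (c i))" and "v = (\<chi> i. nat (- c i))"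
    have "rat_vec (\<Sum>i\<in>UNIV. c i *s g i) = of_int N *s (\<Sum>i\<in>UNIV. q i *s G i)"
      by (simp add: rat_vec_sum rat_vec_simps N G_def vec.scale_sum_right vector_smult_assoc)
    then have "rat_vec (\<Sum>i\<in>UNIV. c i *s g i) = rat_vec 0" by (simp add: q rat_vec_simps)
    then have "(\<Sum>i\<in>UNIV. c i *s g i) = 0" by (rule iffD1[OF rat_vec_simps(3)])
    moreover have "deg u - deg v = (\<Sum>i\<in>UNIV. c i *s g i)"
      unfolding factor_map_def sum_subtractf[symmetric]
      by (intro sum.cong refl) (simp add: u_def v_def vec_eq_iff flip: left_diff_distrib)
    ultimately have uv: "deg u = deg v" by simp
    have "u = v"
    proof (rule ccontr)
      assume "u \<noteq> v"
      then obtain \<alpha> \<alpha>' where \<alpha>: "\<alpha> \<in> Z" "\<alpha> \<le> u" "\<alpha>' \<in> Z" "\<alpha>' \<le> v"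
        using related_imp_reducible uv by metis
      \<comment> \<open>The coefficients vanish on \<open>J\<close>, so a factorization of \<beta>
        below \<open>u\<close> or \<open>v\<close> has no pivot in \<open>J\<close>; only
        \<open>\<alpha>\<^sub>0\<close> qualifies.\<close>
      have *: "x = \<alpha>\<^sub>0" if "x \<in> Z" "x \<le> y" "y = u \<or> y = v" for x y
      proof (rule ccontr)
        assume "x \<noteq> \<alpha>\<^sub>0"
        then have "j x \<in> J" using that by (simp add: J_def)
        then have "c (j x) = 0" using N q(2)[of "j x"] by (metis mult_zero_right of_int_eq_0_iff)
        then have "y $ j x = 0" using that(3) by (auto simp: u_def v_def)
        then show False using j[OF that(1)] that(2) by (metis le_zero_eq less_eq_vec_def)
      qed
      \<comment> \<open>Now \<open>\<alpha>\<^sub>0\<close> lies below both \<open>u\<close> and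
        \<open>v\<close>, although their supports are disjoint.\<close>
      have "\<alpha>\<^sub>0 $ j \<alpha>\<^sub>0 \<le> u $ j \<alpha>\<^sub>0" "\<alpha>\<^sub>0 $ j \<alpha>\<^sub>0 \<le> v $ j \<alpha>\<^sub>0"
        using * \<alpha> by (metis less_eq_vec_def)+
      moreover have "u $ i = 0 \<or> v $ i = 0" for i by (auto simp: u_def v_def)
      ultimately show False using j[OF \<alpha>\<^sub>0] by (metis le_zero_eq)
    qed
    then have "nat (c i) = nat (- c i)" by (simp add: u_def v_def vec_eq_iff)
    then have "c i = 0" by simp
    then show ?thesis using N by (metis mult_eq_0_iff of_int_0 of_int_eq_0_iff)
  qed

  have inj: "inj_on G (- J)"
  proof (rule inj_onI, rule ccontr)
    fix i i' assume i: "i \<in> - J" "i' \<in> - J" "G i = G i'" "i \<noteq> i'"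
    define q :: "'m \<Rightarrow> rat" where "q x = (if x = i then 1 else 0) - (if x = i' then 1 else 0)" for x
    have sum_q: "(\<Sum>x\<in>UNIV. q x *s G x) = G i - G i'"
      by (simp add: q_def vec.scale_left_diff_distrib sum_subtractf if_distrib[of "\<lambda>c. c *s _"] cong: if_cong)
    have "q i = 0"
    proof (rule indep)
      show "(\<Sum>x\<in>UNIV. q x *s G x) = 0" unfolding sum_q i(3) by simp
      show "q x = 0" if "x \<in> J" for x
      proof -
        have "x \<noteq> i" "x \<noteq> i'" using that i(1,2) by blast+
        then show ?thesis by (simp add: q_def)
      qed
    qed
    then show False using i(4) by (simp add: q_def)
  qed

  have "vec.independent (G ` (- J))"
  proof (subst vec.dependent_finite)
    show "\<not> (\<exists>p. (\<exists>x\<in>G ` (- J). p x \<noteq> 0) \<and> (\<Sum>x\<in>G ` (- J). p x *s x) = 0)"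
    proof (intro notI; elim exE conjE bexE)
      fix p x assume p: "x \<in> G ` (- J)" "p x \<noteq> 0" "(\<Sum>x\<in>G ` (- J). p x *s x) = 0"
      define q where "q i = (if i \<in> J then 0 else p (G i))" for i
      have "(\<Sum>i\<in>UNIV. q i *s G i) = (\<Sum>i\<in>- J. p (G i) *s G i)"
        by (rule sum.mono_neutral_cong_right) (auto simp: q_def)
      also have "\<dots> = 0" using p(3) by (simp add: sum.reindex[OF inj])
      finally have "q i = 0" for i by (rule indep) (simp add: q_def)
      moreover obtain i where "x = G i" "i \<notin> J" using p(1) by auto
      ultimately show False using p(2) by (metis q_def)
    qed
  qed simp
  moreover have "UNIV \<subseteq> vec.span (G ` (- J))"
  proof
    fix y :: "rat ^ 'k"
    have off: "G i \<in> vec.span (G ` (- J))" if "i \<notin> J" for i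
      using that by (intro vec.span_base) auto
    have "G i \<in> vec.span (G ` (- J))" for i
    proof (cases "i \<in> J")
      case True
      then obtain \<alpha> where \<alpha>: "\<alpha> \<in> Z" "\<alpha> \<noteq> \<alpha>\<^sub>0" "i = j \<alpha>" by (auto simp: J_def)
      \<comment> \<open>The two factorizations \<alpha> and \<open>\<alpha>\<^sub>0\<close> of
        \<beta> give a relation whose only pivot generator is \<open>G i\<close>; solve it for
        \<open>G i\<close>.\<close>
      have "rat_vec (deg \<alpha>) = rat_vec (deg \<alpha>\<^sub>0)" using \<alpha> \<alpha>\<^sub>0 by simp
      then have "(\<Sum>x\<in>UNIV. of_nat (\<alpha> $ x) *s G x) = (\<Sum>x\<in>UNIV. of_nat (\<alpha>\<^sub>0 $ x) *s G x)"
        by (simp add: factor_map_def rat_vec_sum rat_vec_simps G_def)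
      also have "(\<Sum>x\<in>UNIV. of_nat (\<alpha> $ x) *s G x) =
          of_nat (\<alpha> $ i) *s G i + (\<Sum>x\<in>- J. of_nat (\<alpha> $ x) *s G x)"
      proof -
        have "\<alpha> $ x = 0" if "x \<in> J" "x \<noteq> i" for x
        proof -
          obtain \<alpha>' where \<alpha>': "\<alpha>' \<in> Z" "x = j \<alpha>'" using \<open>x \<in> J\<close> unfolding J_def by blast
          then have "\<alpha> \<noteq> \<alpha>'" using that(2) \<alpha>(3) by blast
          then show ?thesis unfolding \<alpha>'(2) by (rule j_other[OF \<alpha>(1) \<alpha>'(1)])
        qed
        then have "(\<Sum>x\<in>UNIV. of_nat (\<alpha> $ x) *s G x) = (\<Sum>x\<in>insert i (- J). of_nat (\<alpha> $ x) *s G x)"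
          by (intro sum.mono_neutral_right) auto
        then show ?thesis using True by simp
      qed
      also have "(\<Sum>x\<in>UNIV. of_nat (\<alpha>\<^sub>0 $ x) *s G x) = (\<Sum>x\<in>- J. of_nat (\<alpha>\<^sub>0 $ x) *s G x)"
        by (intro sum.mono_neutral_right) (auto simp: \<alpha>\<^sub>0_J)
      finally have eq: "of_nat (\<alpha> $ i) *s G i =
          (\<Sum>x\<in>- J. of_nat (\<alpha>\<^sub>0 $ x) *s G x) - (\<Sum>x\<in>- J. of_nat (\<alpha> $ x) *s G x)"
        by (simp add: algebra_simps)
      have "of_nat (\<alpha> $ i) *s G i \<in> vec.span (G ` (- J))"
        unfolding eq by (intro vec.span_diff vec.span_sum vec.span_scale off) auto
      then have "inverse (of_nat (\<alpha> $ i)) *s (of_nat (\<alpha> $ i) *s G i) \<in> vec.span (G ` (- J))"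
        by (rule vec.span_scale)
      then show ?thesis using j[OF \<alpha>(1)] \<alpha>(3) by (simp add: vector_smult_assoc)
    qed (rule off)
    \<comment> \<open>The hypothesis that the generators span all integer vectors enters
      here.\<close>
    moreover have "axis i 1 \<in> vec.span (range G)" for i
    proof -
      obtain c where "axis i 1 = (\<Sum>x\<in>UNIV. c x *s g x)" using assms by blast
      then have "rat_vec (axis i 1) = (\<Sum>x\<in>UNIV. of_int (c x) *s G x)"
        by (simp add: rat_vec_sum rat_vec_simps G_def)
      moreover have "rat_vec (axis i 1) = axis i 1" by (simp add: rat_vec_def axis_def vec_eq_iff)
      ultimately have "axis i 1 = (\<Sum>x\<in>UNIV. of_int (c x) *s G x)" by simp
      also have "\<dots> \<in> vec.span (range G)"
        by (intro vec.span_sum vec.span_scale vec.span_base rangeI)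
      finally show ?thesis .
    qed
    ultimately have "axis i 1 \<in> vec.span (G ` (- J))" for i
      using vec.span_minimal[OF _ vec.subspace_span, of "range G" "G ` (- J)"] by blast
    then have "(\<Sum>i\<in>UNIV. (y $ i) *s axis i 1) \<in> vec.span (G ` (- J))"
      by (intro vec.span_sum vec.span_scale)
    then show "y \<in> vec.span (G ` (- J))" by (simp add: basis_expansion)
  qed
  ultimately have "card (G ` (- J)) = CARD('k)"
    using vec.basis_card_eq_dim[of "G ` (- J)" UNIV] vec_dim_card[where 'a = rat] by simp
  moreover have "card (G ` (- J)) = CARD('m) - r"
    using card_image[OF inj] card_J by (simp add: Compl_eq_Diff_UNIV card_Diff_subset)
  moreover have "r \<le> CARD('m)" using card_J card_mono[of UNIV J] by simp
  ultimately show ?thesis by simp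
qed

end

subsection \<open>Passing from \<open>S\<close> to \<open>S\<^sub>w\<close>\<close>

lemma snoc_vec_nth [simp]: "snoc_vec z l $ Some i = z $ i" "snoc_vec z l $ None = l"
  by (simp_all add: snoc_vec_def)

lemma vec_option_eq_iff:
  "x = y \<longleftrightarrow> (\<forall>i. x $ Some i = y $ Some i) \<and> x $ None = y $ None"
  for x y :: "'a ^ ('k::finite option)"
  by (auto simp: vec_eq_iff split_option_all)

lemma snoc_vec_eq_iff [simp]: "snoc_vec z l = snoc_vec z' l' \<longleftrightarrow> z = z' \<and> l = l'"
  by (simp add: vec_option_eq_iff vec_eq_iff)

lemma snoc_vec_add: "snoc_vec z l + snoc_vec z' l' = snoc_vec (z + z') (l + l')"
  by (simp add: vec_option_eq_iff)

lemma snoc_vec_scale: "c *s snoc_vec z l = snoc_vec (c *s z) (c * l)"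
  by (simp add: vec_option_eq_iff)

lemma snoc_vec_sum: "(\<Sum>i\<in>A. snoc_vec (f i) (h i)) = snoc_vec (sum f A) (sum h A)"
  by (simp add: vec_option_eq_iff)

lemma sum_UNIV_option: "(\<Sum>i\<in>UNIV. f i) = f None + (\<Sum>i\<in>UNIV. f (Some i))"
  for f :: "'n::finite option \<Rightarrow> 'a::comm_monoid_add"
  by (simp add: UNIV_option_conv sum.reindex)

lemma lift_gens_simps [simp]:
  "lift_gens a w None = snoc_vec 0 1" "lift_gens a w (Some i) = snoc_vec (a i) (int (w i))"
  by (simp_all add: lift_gens_def)

lemma factor_map_lift_gens:
  "factor_map (lift_gens a w) u =
     snoc_vec (factor_map a (\<chi> i. u $ Some i)) (int (u $ None) + (\<Sum>i\<in>UNIV. int (u $ Some i) * int (w i)))"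
  unfolding factor_map_def
  by (simp add: sum_UNIV_option snoc_vec_scale snoc_vec_sum snoc_vec_add)

lemma sum_lift_gens:
  fixes a :: "'n::finite \<Rightarrow> int ^ 'd::finite"
  shows "(\<Sum>i\<in>Some ` A. lift_gens a w i) = snoc_vec (\<Sum>i\<in>A. a i) (\<Sum>i\<in>A. int (w i))"
    and "(\<Sum>i\<in>insert None (Some ` A). lift_gens a w i) =
      snoc_vec (\<Sum>i\<in>A. a i) ((\<Sum>i\<in>A. int (w i)) + 1)"
  by (simp_all add: sum.reindex snoc_vec_sum snoc_vec_add)

text \<open>If generator \<open>i\<close> occurs in a factorization of 0, the remaining part
  represents \<open>- a i\<close>, so pointedness forces \<open>a i = 0\<close>.\<close>

lemma faithful_gens_of_pointed:
  fixes a :: "'n::finite \<Rightarrow> int ^ 'd::finite"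
  assumes "pointed (monoid_gen a)" "\<And>i. a i \<noteq> 0"
  shows "faithful_gens a"
proof
  fix u assume u: "factor_map a u = 0"
  show "u = 0"
  proof (rule ccontr)
    assume "u \<noteq> 0"
    then obtain i where "u $ i \<noteq> 0" by (auto simp: vec_eq_iff)
    then have "axis i 1 \<le> u" by (auto simp: less_eq_vec_def axis_def)
    then obtain t where "u = axis i 1 + t" by (auto simp: nat_vec_le_iff_add)
    then have "a i + factor_map a t = 0" using u by (simp add: factor_map_add factor_map_axis del: One_nat_def)
    then have "a i = - factor_map a t" by (simp add: eq_neg_iff_add_eq_0)
    moreover have "a i \<in> monoid_gen a" "factor_map a t \<in> monoid_gen a"
      using factor_map_axis[of a i] by (metis monoid_gen_eq_range rangeI)+
    ultimately have "a i \<in> monoid_gen a \<inter> uminus ` monoid_gen a" by blast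
    then have "a i \<in> {0}" using assms(1) by (simp only: pointed_def)
    then show False using assms(2) by simp
  qed
qed

text \<open>The first coordinates kill all entries except the one at \<open>None\<close>; the last
  coordinate then kills that one.\<close>

lemma faithful_gens_lift:
  assumes "faithful_gens a"
  shows "faithful_gens (lift_gens a w)"
proof
  fix u assume "factor_map (lift_gens a w) u = 0"
  also have "0 = snoc_vec 0 0" by (simp add: vec_option_eq_iff)
  finally have "factor_map a (\<chi> i. u $ Some i) = 0"
    "int (u $ None) + (\<Sum>i\<in>UNIV. int (u $ Some i) * int (w i)) = 0"
    by (simp_all add: factor_map_lift_gens)
  moreover from this have "(\<chi> i. u $ Some i) = 0" using assms by (simp add: faithful_gens_def)
  then have "u $ Some i = 0" for i by (simp add: vec_eq_iff)
  ultimately show "u = 0" by (simp add: vec_option_eq_iff)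
qed

lemma group_closure_monoid_gen:
  fixes a :: "'n::finite \<Rightarrow> int ^ 'd::finite"
  assumes "y \<in> group_closure (monoid_gen a)"
  shows "\<exists>c :: 'n \<Rightarrow> int. y = (\<Sum>i\<in>UNIV. c i *s a i)"
  using assms
proof induction
  case (base s)
  then have "s \<in> range (factor_map a)"
    using factor_map_0[of a] by (metis insert_iff monoid_gen_eq_range rangeI)
  then show ?case by (auto simp: factor_map_def)
next
  case (diff s t)
  then obtain c c' where "s = (\<Sum>i\<in>UNIV. c i *s a i)" "t = (\<Sum>i\<in>UNIV. c' i *s a i)" by blast
  then show ?case
    by (intro exI[of _ "\<lambda>i. c i - c' i"]) (simp add: vec_eq_iff left_diff_distrib sum_subtractf)
qed

lemma integer_combination_lift:
  fixes a :: "'n::finite \<Rightarrow> int ^ 'd::finite"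
  assumes "\<And>y. \<exists>c :: 'n \<Rightarrow> int. y = (\<Sum>i\<in>UNIV. c i *s a i)"
  shows "\<exists>c :: 'n option \<Rightarrow> int. y = (\<Sum>i\<in>UNIV. c i *s lift_gens a w i)"
proof -
  obtain c where "(\<chi> i. y $ Some i) = (\<Sum>i\<in>UNIV. c i *s a i)" using assms by blast
  \<comment> \<open>The generator \<open>snoc_vec 0 1\<close> corrects the last coordinate without
    disturbing the others.\<close>
  then have "y = (\<Sum>i\<in>UNIV. (case i of None \<Rightarrow> y $ None - (\<Sum>i\<in>UNIV. c i * int (w i)) | Some j \<Rightarrow> c j)
      *s lift_gens a w i)"
    by (simp add: sum_UNIV_option vec_option_eq_iff vec_eq_iff)
  then show ?thesis by blast
qed

theorem theorem5p4:
  fixes a :: "'n::finite \<Rightarrow> int ^ 'd::finite"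
    and w :: "'n \<Rightarrow> nat"
    and b z :: "int ^ 'd"
    and d\<^sub>w lam :: int
    and k :: "'n set \<Rightarrow> nat"
    and l :: "'n set \<Rightarrow> int"
  assumes "affine_semigroup (monoid_gen a)"
    and "pointed (monoid_gen a)"
    and "\<And>i. a i \<noteq> 0"
    and "Betti a = {b}"
    and "Betti (lift_gens a w) = {snoc_vec b d\<^sub>w}"
    and "snoc_vec z lam \<in> monoid_gen (lift_gens a w)"
    and "\<And>A. A \<in> frak_a a b z \<Longrightarrow> z = (\<Sum>i\<in>A. a i) + int (k A) *s b"
    and "\<And>A. A \<in> frak_a a b z \<Longrightarrow> l A = (\<Sum>i\<in>A. int (w i)) + int (k A) * d\<^sub>w"
  shows "(frak_a a b z = {} \<or> lam \<notin> (\<Union>A\<in>frak_a a b z. {l A, l A + 1}) \<longrightarrow>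
            moebius_fun (monoid_gen (lift_gens a w)) (snoc_vec z lam) = 0) \<and>
         (frak_a a b z \<noteq> {} \<and> lam \<in> (\<Union>A\<in>frak_a a b z. {l A, l A + 1}) \<longrightarrow>
            moebius_fun (monoid_gen (lift_gens a w)) (snoc_vec z lam) =
              (\<Sum>A | A \<in> frak_a a b z \<and> lam = l A.
                 (-1) ^ card A * int ((k A + CARD('n) - CARD('d) - 1) choose k A))
            - (\<Sum>A | A \<in> frak_a a b z \<and> lam = l A + 1.
                 (-1) ^ card A * int ((k A + CARD('n) - CARD('d) - 1) choose k A)))"
proof -
  have a: "faithful_gens a" using assms(2,3) by (rule faithful_gens_of_pointed)
  interpret S: unique_betti a b
    using a assms(4) by (simp add: unique_betti_def unique_betti_axioms_def)
  interpret Sw: unique_betti "lift_gens a w" "snoc_vec b d\<^sub>w"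
    using faithful_gens_lift[OF a] assms(5) by (simp add: unique_betti_def unique_betti_axioms_def)
  have "\<exists>c :: 'n \<Rightarrow> int. y = (\<Sum>i\<in>UNIV. c i *s a i)" for y
    using assms(1) group_closure_monoid_gen[of y a] by (simp add: affine_semigroup_def)
  then have "CARD('n option) = CARD('d option) + Sw.r"
    by (intro Sw.card_gens integer_combination_lift)
  \<comment> \<open>Generators and dimension both grow by one, so \<open>Sw.r\<close> is n - d. As
    it is positive, the natural subtraction in the binomial coefficients is exact.\<close>
  then have card: "CARD('n) = CARD('d) + Sw.r" by simp

  define E where "E m = {A \<in> frak_a a b z. lam = l A + m}" for m
  define f where "f = (\<lambda>A :: 'n set. (-1) ^ card A * int ((k A + CARD('n) - CARD('d) - 1) choose k A))"
  \<comment> \<open>Since \<open>b\<close> is nonzero, the multiplicity is determined by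
    \<open>A\<close>, so it must be the given \<open>k A\<close>.\<close>
  have mem_frak: "z = (\<Sum>i\<in>A. a i) + int m *s b \<longleftrightarrow> A \<in> frak_a a b z \<and> m = k A" for A m
  proof
    assume z: "z = (\<Sum>i\<in>A. a i) + int m *s b"
    then have A: "A \<in> frak_a a b z" by (auto simp: frak_a_def)
    then have "int m *s b = int (k A) *s b" using z assms(7)[OF A] by (metis add_left_cancel)
    moreover obtain i where "b $ i \<noteq> 0" using S.betti_nonzero by (auto simp: vec_eq_iff)
    ultimately have "m = k A" by (auto simp: vec_eq_iff)
    then show "A \<in> frak_a a b z \<and> m = k A" using A by simp
  qed (use assms(7) in blast)
  \<comment> \<open>\<open>None\<close> adds nothing to the first coordinates and 1 to the last,
    which separates \<open>lam = l A\<close> from \<open>lam = l A + 1\<close>.\<close>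
  have expansions: "Sw.expansions (snoc_vec z lam) =
      (\<lambda>A. (Some ` A, k A)) ` E 0 \<union> (\<lambda>A. (insert None (Some ` A), k A)) ` E 1" (is "?X = ?Y")
  proof (intro equalityI subsetI)
    fix p assume "p \<in> ?X"
    then obtain B m where p: "p = (B, m)"
      "snoc_vec z lam = (\<Sum>i\<in>B. lift_gens a w i) + int m *s snoc_vec b d\<^sub>w"
      by (auto simp: Sw.expansions_def)
    define A where "A = Some -` B"
    have "B = Some ` A \<or> B = insert None (Some ` A)"
      unfolding A_def by (auto simp: image_iff) (metis option.exhaust)+
    then show "p \<in> ?Y"
    proof
      assume B: "B = Some ` A"
      then have "z = (\<Sum>i\<in>A. a i) + int m *s b" "lam = (\<Sum>i\<in>A. int (w i)) + int m * d\<^sub>w"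
        using p(2) by (simp_all add: sum_lift_gens snoc_vec_add snoc_vec_scale)
      then have "A \<in> E 0" "m = k A" using mem_frak assms(8) by (auto simp: E_def)
      then show ?thesis using p(1) B by blast
    next
      assume B: "B = insert None (Some ` A)"
      then have "z = (\<Sum>i\<in>A. a i) + int m *s b" "lam = (\<Sum>i\<in>A. int (w i)) + 1 + int m * d\<^sub>w"
        using p(2) by (simp_all add: sum_lift_gens snoc_vec_add snoc_vec_scale del: sum.insert)
      then have "A \<in> E 1" "m = k A" using mem_frak assms(8) by (auto simp: E_def)
      then show ?thesis using p(1) B by blast
    qed
  next
    fix p assume "p \<in> ?Y"
    then show "p \<in> ?X"
      using assms(7,8)
      by (auto simp: E_def Sw.expansions_def sum_lift_gens snoc_vec_add snoc_vec_scale simp del: sum.insert)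
  qed
  have "moebius_fun (monoid_gen (lift_gens a w)) (snoc_vec z lam) =
      (\<Sum>(A, m)\<in>?X. (-1) ^ card A * int ((m + Sw.r - 1) choose m))"
    by (rule Sw.moebius_fun_expansions)
  also have "\<dots> = (\<Sum>(A, m)\<in>(\<lambda>A. (Some ` A, k A)) ` E 0. (-1) ^ card A * int ((m + Sw.r - 1) choose m)) +
      (\<Sum>(A, m)\<in>(\<lambda>A. (insert None (Some ` A), k A)) ` E 1. (-1) ^ card A * int ((m + Sw.r - 1) choose m))"
    unfolding expansions by (rule sum.union_disjoint) auto
  \<comment> \<open>For \<open>E 1\<close> the extra element \<open>None\<close> raises the
    cardinality by one; hence the minus sign.\<close>
  also have "\<dots> = sum f (E 0) - sum f (E 1)"
    by (subst (1 2) sum.reindex)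
      (auto simp: inj_on_def inj_image_eq_iff f_def card card_image sum_negf)
  finally have main: "moebius_fun (monoid_gen (lift_gens a w)) (snoc_vec z lam) = sum f (E 0) - sum f (E 1)" .
  have empty: "E 0 = {}" "E 1 = {}" if "frak_a a b z = {} \<or> lam \<notin> (\<Union>A\<in>frak_a a b z. {l A, l A + 1})"
    using that by (auto simp: E_def)
  show ?thesis
  proof (intro conjI impI)
    assume "frak_a a b z = {} \<or> lam \<notin> (\<Union>A\<in>frak_a a b z. {l A, l A + 1})"
    then show "moebius_fun (monoid_gen (lift_gens a w)) (snoc_vec z lam) = 0"
      unfolding main by (simp only: empty sum.empty diff_self)
  qed (simp only: main E_def f_def add_0_right)
qed

end
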